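(* For every integer $s\geq 1$, the subgraph $\mathcal{G}^s\subset\mathcal{G}$ of O-sequences of length $s$ is a rooted connected graph with root $(1^s)=(1,\ldots,1)$ ($s$ entries equal to $1$), and it contains a spanning tree $\mathcal{T}^s$ with the same root.
   Context: Binomial expansion: for positive integers $a,t$ write uniquely $a=\binom{k(t)}{t}+\binom{k(t-1)}{t-1}+\cdots+\binom{k(j)}{j}$ with $k(t)>k(t-1)>\cdots>k(j)\geq j\geq 1$, and set $a^{\langle t\rangle}:=\binom{k(t)+1}{t+1}+\binom{k(t-1)+1}{t}+\cdots+\binom{k(j)+1}{j+1}$; also $0^{\langle t\rangle}:=0$. A function $\mathsf{h}:\mathbb{N}\to\mathbb{N}$ is an O-sequence (admissible) if $\mathsf{h}(0)=1$ and $\mathsf{h}(t+1)\leq \mathsf{h}(t)^{\langle t\rangle}$ for every $t\geq 1$. It is finite if $\mathsf{h}(t)=0$ for some $t$ (and then for all larger arguments); a finite O-sequence is written $(h_0,\ldots,h_{s-1})$ with $h_{s-1}\neq 0$, and $s$ is its length. Finite sequences are extended by zeros when added or subtracted, and $\mathsf{e}_i$ denotes the sequence that is $1$ at index $i$ (indices starting from $0$) and $0$ elsewhere. The O-sequences graph $\mathcal{G}$ is the directed graph whose vertices are all the finite O-sequences and whose edges are the pairs $(\mathsf{h},\mathsf{h}')$ of finite O-sequences such that $\mathsf{h}'-\mathsf{h}=\mathsf{e}_i$ for some $i$ (edge from $\mathsf{h}$ to $\mathsf{h}'$). $\mathcal{G}^s$ is the subgraph induced on the set of O-sequences of length $s$.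 "Rooted with root $r$" and "connected" mean that every vertex can be reached from $r$ by a directed path; a spanning tree with root $r$ is a subgraph with the same vertices in which every vertex is reached from $r$ by a unique directed path. *)

theory Defs
  imports Complex_Main "Graph_Theory.Digraph_Component"
begin

text \<open>
  \<open>a = (k t choose t) + \<dots> + (k j choose j)\<close> with \<open>k t > \<dots> > k j \<ge> j \<ge> 1\<close>;
  only the values of \<open>k\<close> on \<open>{j..t}\<close> matter.
\<close>

definition binomial_expansion :: "nat \<Rightarrow> nat \<Rightarrow> nat \<Rightarrow> (nat \<Rightarrow> nat) \<Rightarrow> bool" where
  "binomial_expansion a t j k \<longleftrightarrow>
     1 \<le> j \<and> j \<le> t \<and> j \<le> k j \<and> strict_mono_on {j..t} k \<and>
     a = (\<Sum>i = j..t. k i choose i)"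

text \<open>
  The operation written \<open>a\<^sup>\<langle>\<^sup>t\<^sup>\<rangle>\<close>. It is meaningful for \<open>t \<ge> 1\<close> only: for \<open>a, t \<ge> 1\<close> the
  binomial expansion exists and is unique on \<open>{j..t}\<close>, so the description is well defined.
\<close>

definition macaulay_up :: "nat \<Rightarrow> nat \<Rightarrow> nat" where
  "macaulay_up a t =
     (if a = 0 then 0
      else (THE b. \<exists>j k. binomial_expansion a t j k \<and>
                         b = (\<Sum>i = j..t. (k i + 1) choose (i + 1))))"

definition O_sequence :: "(nat \<Rightarrow> nat) \<Rightarrow> bool" where
  "O_sequence h \<longleftrightarrow> h 0 = 1 \<and> (\<forall>t\<ge>1. h (t + 1) \<le> macaulay_up (h t) t)"

definition finite_O_sequence :: "(nat \<Rightarrow> nat) \<Rightarrow> bool" where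
  "finite_O_sequence h \<longleftrightarrow> O_sequence h \<and> (\<exists>t. h t = 0)"

text \<open>
  Finite sequences are represented by their extension by zeros, so the length is one more
  than the index of the last nonzero entry.
\<close>

definition seq_length :: "(nat \<Rightarrow> nat) \<Rightarrow> nat" where
  "seq_length h = (LEAST s. \<forall>t\<ge>s. h t = 0)"

definition unit_seq :: "nat \<Rightarrow> nat \<Rightarrow> int" where
  "unit_seq i = (\<lambda>n. if n = i then 1 else 0)"

definition ones :: "nat \<Rightarrow> nat \<Rightarrow> nat" where
  "ones s = (\<lambda>n. if n < s then 1 else 0)"

type_synonym seq_digraph = "(nat \<Rightarrow> nat, (nat \<Rightarrow> nat) \<times> (nat \<Rightarrow> nat)) pre_digraph"

text \<open>The difference of sequences is taken in the integers, as subtraction on \<open>nat\<close> truncates.\<close>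

definition O_graph :: seq_digraph where
  "O_graph =
     \<lparr> verts = {h. finite_O_sequence h},
       arcs = {(h, h'). finite_O_sequence h \<and> finite_O_sequence h' \<and>
                 (\<exists>i. (\<lambda>n. int (h' n) - int (h n)) = unit_seq i)},
       tail = fst,
       head = snd \<rparr>"

definition O_graph_length :: "nat \<Rightarrow> seq_digraph" where
  "O_graph_length s = O_graph \<restriction> {h. finite_O_sequence h \<and> seq_length h = s}"

definition rooted_connected :: "('a, 'b) pre_digraph \<Rightarrow> 'a \<Rightarrow> bool" where
  "rooted_connected G r \<longleftrightarrow> r \<in> verts G \<and> (\<forall>v \<in> verts G. r \<rightarrow>\<^sup>*\<^bsub>G\<^esub> v)"

text \<open>
  The library's \<open>spanning_tree\<close> concerns symmetric digraphs, so it is not usable here.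
  Uniqueness is required among all directed walks \<open>awalk\<close>: the unique walk is then
  automatically a simple path \<open>apath\<close>, and arcs closing a directed cycle, which uniqueness
  among simple paths alone would permit, are excluded.
\<close>

definition rooted_spanning_tree ::
    "('a, 'b) pre_digraph \<Rightarrow> ('a, 'b) pre_digraph \<Rightarrow> 'a \<Rightarrow> bool" where
  "rooted_spanning_tree T G r \<longleftrightarrow>
     spanning T G \<and> r \<in> verts T \<and> (\<forall>v \<in> verts T. \<exists>!p. pre_digraph.awalk T r p v)"

end

theory Submission
  imports Defs
begin

text \<open>
  Let \<open>h\<close> be a finite O-sequence of length \<open>s\<close> other than \<open>(1\<^sup>s)\<close>, and let \<open>i\<close> be the last index with
  \<open>h i > 1\<close>. Lowering \<open>h i\<close> by one gives an O-sequence again: the only growth bound that gets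
  sharper is the one on \<open>h (i + 1) \<le> 1\<close>, and \<open>a\<^sup>\<langle>\<^sup>t\<^sup>\<rangle> \<ge> 1\<close> for every \<open>a \<ge> 1\<close>. So every vertex but
  \<open>(1\<^sup>s)\<close> has an incoming edge from a vertex with a smaller sum of entries, and keeping one such
  edge per vertex gives the tree.
\<close>

section \<open>Binomial expansions\<close>

lemma not_binomial_expansion_0: "\<not> binomial_expansion a 0 j k"
  by (auto simp: binomial_expansion_def)

text \<open>Splitting off the top binomial lets the facts below go by induction on \<open>t\<close>:
  what remains is either nothing or an expansion of smaller degree with the same \<open>j\<close>
  and \<open>k\<close>.\<close>

lemma binomial_expansion_Suc:
  "binomial_expansion a (Suc t) j k \<longleftrightarrow>
     (j = Suc t \<and> Suc t \<le> k (Suc t) \<and> a = k (Suc t) choose Suc t) \<or>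
     (\<exists>r. binomial_expansion r t j k \<and> k t < k (Suc t) \<and> a = (k (Suc t) choose Suc t) + r)"
proof (cases "1 \<le> j \<and> j \<le> t")
  case True
  then have "strict_mono_on {j..Suc t} k \<longleftrightarrow> strict_mono_on {j..t} k \<and> k t < k (Suc t)"
  proof (intro iffI conjI)
    assume mono: "strict_mono_on {j..Suc t} k"
    then show "strict_mono_on {j..t} k"
      by (rule monotone_on_subset) simp
    show "k t < k (Suc t)"
      using mono True by (intro strict_mono_onD[OF mono]) auto
  next
    assume "strict_mono_on {j..t} k \<and> k t < k (Suc t)"
    then have mono: "strict_mono_on {j..t} k" and less: "k t < k (Suc t)"
      by auto
    show "strict_mono_on {j..Suc t} k"
    proof (rule strict_mono_onI)
      fix x y assume xy: "x \<in> {j..Suc t}" "y \<in> {j..Suc t}" "x < y"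
      show "k x < k y"
      proof (cases "y = Suc t")
        case True
        with xy have "k x \<le> k t"
          using strict_mono_on_leD[OF mono, of x t] by auto
        with less True show ?thesis by simp
      next
        case False
        with xy show ?thesis
          using strict_mono_onD[OF mono, of x y] by auto
      qed
    qed
  qed
  moreover have "(\<Sum>i = j..Suc t. k i choose i) = (k (Suc t) choose Suc t) + (\<Sum>i = j..t. k i choose i)"
    using True by simp
  ultimately show ?thesis
    using True by (auto simp: binomial_expansion_def)
next
  case False
  then have "\<not> binomial_expansion r t j k" for r
    by (auto simp: binomial_expansion_def)
  with False show ?thesis
    by (auto simp: binomial_expansion_def strict_mono_on_def le_Suc_eq)
qed

lemma binomial_expansion_top_ge:
  assumes "binomial_expansion a t j k"
  shows "t \<le> k t"
  using assms
proof (induction t arbitrary: a)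
  case 0
  then show ?case by simp
next
  case (Suc t)
  then have "Suc t \<le> k (Suc t) \<or> (\<exists>r. binomial_expansion r t j k \<and> k t < k (Suc t))"
    by (auto simp: binomial_expansion_Suc)
  then show ?case
    using Suc.IH by fastforce
qed

lemma binomial_expansion_lower:
  assumes "binomial_expansion a t j k"
  shows "k t choose t \<le> a"
  using assms by (cases t) (auto simp: not_binomial_expansion_0 binomial_expansion_Suc)

lemma binomial_expansion_pos:
  assumes "binomial_expansion a t j k"
  shows "0 < a"
proof -
  have "0 < k t choose t"
    using binomial_expansion_top_ge[OF assms] by simp
  with binomial_expansion_lower[OF assms] show ?thesis
    by linarith
qed

text \<open>By induction the tail below the top term is less than \<open>k (Suc t) choose t\<close>,
  and Pascal's rule absorbs it. With \<open>binomial_expansion_lower\<close> this identifies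
  \<open>k t\<close> as the largest \<open>m\<close> with \<open>m choose t \<le> a\<close>.\<close>

lemma binomial_expansion_upper:
  assumes "binomial_expansion a t j k"
  shows "a < Suc (k t) choose t"
  using assms
proof (induction t arbitrary: a)
  case 0
  then show ?case by (simp add: not_binomial_expansion_0)
next
  case (Suc t)
  from Suc.prems consider "Suc t \<le> k (Suc t)" "a = k (Suc t) choose Suc t"
    | r where "binomial_expansion r t j k" "k t < k (Suc t)" "a = (k (Suc t) choose Suc t) + r"
    by (auto simp: binomial_expansion_Suc)
  then show ?case
  proof cases
    case 1
    then show ?thesis by simp
  next
    case (2 r)
    have "r < Suc (k t) choose t"
      using Suc.IH 2(1) .
    also have "\<dots> \<le> k (Suc t) choose t"
      using 2(2) by (intro binomial_right_mono) simp
    finally show ?thesis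
      using 2(3) by simp
  qed
qed

text \<open>Greedy construction: take the largest binomial that fits into \<open>a\<close>, then
  expand the remainder one degree lower.\<close>

lemma ex_binomial_expansion:
  assumes "1 \<le> a" "1 \<le> t"
  shows "\<exists>j k. binomial_expansion a t j k"
  using assms
proof (induction t arbitrary: a)
  case 0
  then show ?case by simp
next
  case (Suc t)
  show ?case
  proof (cases "t = 0")
    case True
    have "binomial_expansion a (Suc t) (Suc t) (\<lambda>_. a)"
      using Suc.prems True by (simp add: binomial_expansion_Suc)
    then show ?thesis by blast
  next
    case False
    define K where "K = (GREATEST m. m choose Suc t \<le> a)"
    \<comment> \<open>\<open>GREATEST\<close> is meaningful only for a bounded set. The bound comes
      from \<open>Suc n \<le> (n + Suc t) choose Suc t\<close> at \<open>n = a\<close>.\<close>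
    have bound: "m \<le> a + t" if "m choose Suc t \<le> a" for m
    proof (rule ccontr)
      assume "\<not> m \<le> a + t"
      then have "(a + Suc t) choose Suc t \<le> a"
        using binomial_right_mono[of "a + Suc t" m "Suc t"] that by linarith
      moreover have "Suc n \<le> (n + Suc t) choose Suc t" for n
      proof (induction n)
        case (Suc n)
        have "Suc n + Suc t choose Suc t = (n + Suc t choose t) + (n + Suc t choose Suc t)"
          by simp
        moreover have "0 < n + Suc t choose t" by simp
        ultimately show ?case using Suc by linarith
      qed simp
      ultimately show False
        using Suc_n_not_le_n le_trans by blast
    qed
    have K: "K choose Suc t \<le> a"
      unfolding K_def by (rule GreatestI_nat[of _ "Suc t"]) (use bound Suc.prems in auto)
    have "\<not> Suc K choose Suc t \<le> a"
      using Greatest_le_nat[of "\<lambda>m. m choose Suc t \<le> a" "Suc K" "a + t"] bound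
      unfolding K_def by force
    then have K': "a < (K choose t) + (K choose Suc t)"
      by simp
    have "Suc t \<le> K"
      unfolding K_def by (rule Greatest_le_nat) (use bound Suc.prems in auto)
    show ?thesis
    proof (cases "a = K choose Suc t")
      case True
      then have "binomial_expansion a (Suc t) (Suc t) (\<lambda>_. K)"
        using \<open>Suc t \<le> K\<close> by (simp add: binomial_expansion_Suc)
      then show ?thesis by blast
    next
      case neq: False
      \<comment> \<open>Maximality of \<open>K\<close> and Pascal's rule give
        \<open>r < K choose t\<close>. This forces the top entry of the expansion of
        \<open>r\<close> below \<open>K\<close>, so the entries stay strictly increasing.\<close>
      define r where "r = a - (K choose Suc t)"
      have r: "1 \<le> r" "a = (K choose Suc t) + r" "r < K choose t"
        using neq K K' by (auto simp: r_def)
      then obtain j k where jk: "binomial_expansion r t j k"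
        using Suc.IH[of r] False by auto
      have "k t choose t < K choose t"
        using binomial_expansion_lower[OF jk] r by linarith
      then have "k t < K"
        using binomial_right_mono[of K "k t" t] by linarith
      \<comment> \<open>The expansion of \<open>r\<close> reads \<open>k\<close> only up to
        \<open>t\<close>, so the value at \<open>Suc t\<close> is free to be set.\<close>
      moreover have "binomial_expansion r t j (k(Suc t := K))"
        using jk by (auto simp: binomial_expansion_def strict_mono_on_def)
      ultimately have "binomial_expansion a (Suc t) j (k(Suc t := K))"
        using r by (auto simp: binomial_expansion_Suc)
      then show ?thesis by blast
    qed
  qed
qed

lemma binomial_expansion_top_unique:
  assumes "binomial_expansion a t j k" "binomial_expansion a t j' k'"
  shows "k t = k' t"
proof -
  have "f t \<le> g t" if "binomial_expansion a t i f" "binomial_expansion a t i' g" for i i' f g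
  proof (rule ccontr)
    assume "\<not> f t \<le> g t"
    then have "Suc (g t) choose t \<le> f t choose t"
      by (intro binomial_right_mono) simp
    with binomial_expansion_lower[OF that(1)] binomial_expansion_upper[OF that(2)]
    show False by linarith
  qed
  with assms show ?thesis
    by (metis le_antisym)
qed

lemma binomial_expansion_unique:
  assumes "binomial_expansion a t j k" "binomial_expansion a t j' k'"
  shows "j = j' \<and> (\<forall>i\<in>{j..t}. k i = k' i)"
  using assms
proof (induction t arbitrary: a)
  case 0
  then show ?case by (simp add: not_binomial_expansion_0)
next
  case (Suc t)
  have top: "k (Suc t) = k' (Suc t)"
    using binomial_expansion_top_unique[OF Suc.prems] .
  \<comment> \<open>Once the tops agree, a single-term expansion cannot equal a longer one, since
    the tail of the latter is positive.\<close>
  with Suc.prems consider "j = Suc t" "j' = Suc t"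
    | r where "binomial_expansion r t j k" "binomial_expansion r t j' k'"
    by (auto simp: binomial_expansion_Suc dest: binomial_expansion_pos)
  then show ?case
  proof cases
    case 1
    with top show ?thesis by simp
  next
    case (2 r)
    from Suc.IH[OF this] top show ?thesis
      by (auto simp: le_Suc_eq)
  qed
qed

lemma macaulay_up_0: "macaulay_up 0 t = 0"
  by (simp add: macaulay_up_def)

text \<open>Two expansions of \<open>a\<close> agree on \<open>{j..t}\<close>, the only range the
  sum reads. Hence the definite description has exactly one candidate and any expansion may be used
  to evaluate it.\<close>

lemma macaulay_up_eq:
  assumes "binomial_expansion a t j k"
  shows "macaulay_up a t = (\<Sum>i = j..t. (k i + 1) choose (i + 1))"
proof -
  have "(\<Sum>i = j'..t. (k' i + 1) choose (i + 1)) = (\<Sum>i = j..t. (k i + 1) choose (i + 1))"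
    if "binomial_expansion a t j' k'" for j' k'
    using binomial_expansion_unique[OF that assms] by (intro sum.cong) auto
  then have "(THE b. \<exists>j k. binomial_expansion a t j k \<and> b = (\<Sum>i = j..t. (k i + 1) choose (i + 1))) =
      (\<Sum>i = j..t. (k i + 1) choose (i + 1))"
    using assms by (intro the_equality) blast+
  then show ?thesis
    using binomial_expansion_pos[OF assms] by (simp add: macaulay_up_def)
qed

lemma macaulay_up_pos:
  assumes "1 \<le> a" "1 \<le> t"
  shows "1 \<le> macaulay_up a t"
proof -
  obtain j k where jk: "binomial_expansion a t j k"
    using ex_binomial_expansion[OF assms] by blast
  then have "t \<in> {j..t}"
    by (simp add: binomial_expansion_def)
  then have "(k t + 1) choose (t + 1) \<le> (\<Sum>i = j..t. (k i + 1) choose (i + 1))"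
    by (intro member_le_sum) auto
  moreover have "0 < (k t + 1) choose (t + 1)"
    using binomial_expansion_top_ge[OF jk] by (simp del: binomial_Suc_Suc)
  ultimately show ?thesis
    unfolding macaulay_up_eq[OF jk] by linarith
qed

section \<open>Finite O-sequences\<close>

lemma O_sequence_zero_mono:
  assumes "O_sequence h" "h t = 0" "t \<le> n"
  shows "h n = 0"
  using assms(3)
proof (induction n rule: dec_induct)
  case base
  then show ?case using assms(2) .
next
  case (step n)
  \<comment> \<open>The growth bound starts at index 1; index 0 is excluded because
    \<open>h 0 = 1\<close>.\<close>
  have "n \<noteq> 0"
    using step.IH assms(1) by (auto simp: O_sequence_def intro!: Nat.gr0I)
  then have "h (Suc n) \<le> macaulay_up (h n) n"
    using assms(1) by (simp add: O_sequence_def)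
  then show ?case
    by (simp add: step.IH macaulay_up_0)
qed

text \<open>Zeros persist, so the support has no gaps. Keeping the length therefore amounts to
  keeping the set of zeros.\<close>

lemma finite_O_sequence_eq_0_iff:
  assumes "finite_O_sequence h"
  shows "h t = 0 \<longleftrightarrow> seq_length h \<le> t"
proof
  obtain n where "h n = 0" and O: "O_sequence h"
    using assms by (auto simp: finite_O_sequence_def)
  then have "\<forall>t\<ge>n. h t = 0"
    using O_sequence_zero_mono by blast
  then have "\<forall>t\<ge>seq_length h. h t = 0"
    unfolding seq_length_def by (rule LeastI)
  then show "seq_length h \<le> t \<Longrightarrow> h t = 0"
    by blast
  show "seq_length h \<le> t" if "h t = 0"
    unfolding seq_length_def using O_sequence_zero_mono[OF O that] by (intro Least_le) blast
qed

lemma seq_length_eqI: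
  assumes "\<And>t. h t = 0 \<longleftrightarrow> s \<le> t"
  shows "seq_length h = s"
  unfolding seq_length_def using assms by (intro Least_equality) auto

lemma finite_O_sequence_ones:
  assumes "1 \<le> s"
  shows "finite_O_sequence (ones s)"
  using assms macaulay_up_pos
  by (auto simp: finite_O_sequence_def O_sequence_def ones_def intro!: exI[of _ s])

lemma seq_length_ones: "seq_length (ones s) = s"
  by (rule seq_length_eqI) (simp add: ones_def)

lemma O_sequence_decrement:
  assumes O: "O_sequence h" and i: "1 < h i" and next_le: "h (Suc i) \<le> 1"
  shows "O_sequence (h(i := h i - 1))"
proof -
  let ?g = "h(i := h i - 1)"
  have h: "h 0 = 1" "\<And>t. 1 \<le> t \<Longrightarrow> h (Suc t) \<le> macaulay_up (h t) t"
    using O by (auto simp: O_sequence_def)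
  have "?g (Suc t) \<le> macaulay_up (?g t) t" if "1 \<le> t" for t
  proof (cases "t = i")
    case True
    have "h (Suc i) \<le> macaulay_up (h i - 1) i"
      using macaulay_up_pos[of "h i - 1" i] i next_le that True by linarith
    with True show ?thesis by simp
  next
    case False
    \<comment> \<open>Away from \<open>t = i\<close> the right-hand side of the growth bound is
      unchanged, while the left-hand side can only drop, namely when
      \<open>Suc t = i\<close>.\<close>
    have "?g (Suc t) \<le> h (Suc t)"
      by auto
    also have "\<dots> \<le> macaulay_up (?g t) t"
      using h(2)[OF that] False by simp
    finally show ?thesis .
  qed
  moreover have "i \<noteq> 0"
    using h(1) i by (metis less_irrefl)
  ultimately show ?thesis
    using h(1) by (simp add: O_sequence_def)
qed

lemma ex_decrement:
  assumes h: "finite_O_sequence h" and ne: "h \<noteq> ones (seq_length h)"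
  obtains i where "1 < h i" "finite_O_sequence (h(i := h i - 1))"
    "seq_length (h(i := h i - 1)) = seq_length h"
proof -
  note zero = finite_O_sequence_eq_0_iff[OF h]
  define i where "i = (GREATEST i. 1 < h i)"
  have bound: "n \<le> seq_length h" if "1 < h n" for n
    using that zero[of n] by linarith
  \<comment> \<open>Otherwise all entries are at most 1 and those below the length are nonzero,
    which makes \<open>h\<close> the excluded sequence.\<close>
  have "\<exists>n. 1 < h n"
  proof (rule ccontr)
    assume "\<nexists>n. 1 < h n"
    then have "h n \<le> 1" for n
      by (simp add: not_less)
    then have "h n = ones (seq_length h) n" for n
      using zero[of n] by (fastforce simp: ones_def intro: le_antisym)
    with ne show False by blast
  qed
  then have i: "1 < h i"
    unfolding i_def using bound by (rule GreatestI_ex_nat)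
  have "\<not> 1 < h (Suc i)"
    using Greatest_le_nat[of "\<lambda>i. 1 < h i" "Suc i" "seq_length h"] bound
    unfolding i_def by force
  with i have "O_sequence (h(i := h i - 1))"
    using h by (intro O_sequence_decrement) (auto simp: finite_O_sequence_def)
  \<comment> \<open>Since \<open>1 < h i\<close>, the lowered entry is still positive, so no new
    zero appears.\<close>
  moreover have iff: "(h(i := h i - 1)) t = 0 \<longleftrightarrow> seq_length h \<le> t" for t
    using zero[of t] i by auto
  ultimately have "finite_O_sequence (h(i := h i - 1))"
    unfolding finite_O_sequence_def by blast
  with i iff show thesis
    by (intro that seq_length_eqI)
qed

section \<open>Spanning trees of rooted digraphs\<close>

text \<open>A walk in the tree is a walk in \<open>G\<close> with the same arcs, so connectivity
  follows from the tree.\<close>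

lemma rooted_connected_of_spanning_tree:
  assumes "wf_digraph G" "rooted_spanning_tree T G r"
  shows "rooted_connected G r"
  unfolding rooted_connected_def
proof (intro conjI ballI)
  have sub: "subgraph T G" and eq: "verts G = verts T" and r: "r \<in> verts T"
    using assms(2) by (auto simp: rooted_spanning_tree_def spanning_def)
  show "r \<in> verts G"
    using r eq by simp
  fix v assume "v \<in> verts G"
  then obtain p where "pre_digraph.awalk T r p v"
    using assms(2) eq by (auto simp: rooted_spanning_tree_def)
  then have "pre_digraph.awalk G r p v"
    using sub compatible_cas[of G T] by (auto simp: pre_digraph.awalk_def subgraph_def)
  then show "r \<rightarrow>\<^sup>*\<^bsub>G\<^esub> v"
    using wf_digraph.reachable_awalk[OF assms(1)] by blast
qed

text \<open>Each vertex other than \<open>r\<close> keeps one incoming arc \<open>pa v\<close>. As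
  \<open>\<mu>\<close> decreases along these arcs when followed backwards, the descent terminates,
  and it can only stop at \<open>r\<close>.\<close>

lemma ex_rooted_spanning_tree:
  fixes \<mu> :: "'a \<Rightarrow> nat"
  assumes wf: "wf_digraph G" and r: "r \<in> verts G"
    and ex: "\<And>v. v \<in> verts G \<Longrightarrow> v \<noteq> r \<Longrightarrow> \<exists>e\<in>arcs G. head G e = v \<and> \<mu> (tail G e) < \<mu> v"
  shows "\<exists>T. rooted_spanning_tree T G r"
proof -
  obtain pa where pa: "\<And>v. v \<in> verts G \<Longrightarrow> v \<noteq> r \<Longrightarrow>
      pa v \<in> arcs G \<and> head G (pa v) = v \<and> \<mu> (tail G (pa v)) < \<mu> v"
    using ex by metis
  define T where "T = G\<lparr>arcs := pa ` (verts G - {r})\<rparr>"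
  have T: "verts T = verts G" "arcs T = pa ` (verts G - {r})" "tail T = tail G" "head T = head G"
    by (simp_all add: T_def)
  interpret G: wf_digraph G by fact
  have T_arcs: "arcs T \<subseteq> arcs G"
    using pa by (auto simp: T)
  interpret T: wf_digraph T
    by unfold_locales (use T_arcs G.wellformed in \<open>auto simp: T(1,3,4)\<close>)
  have "spanning T G"
    using T_arcs by (simp add: spanning_def subgraph_def compatible_def T(1,3,4) wf T.wf_digraph_axioms)
  moreover have "\<exists>!p. T.awalk r p v" if "v \<in> verts G" for v
    using that
  proof (induction "\<mu> v" arbitrary: v rule: less_induct)
    case less
    \<comment> \<open>An arc of \<open>T\<close> is \<open>pa u\<close> for some \<open>u\<close>
      other than \<open>r\<close> and has head \<open>u\<close>. So the only arc of \<open>T\<close>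
      into \<open>v\<close> is \<open>pa v\<close>, no arc enters \<open>r\<close>, and walks from
      \<open>r\<close> are determined from their end backwards.\<close>
    have last_arc: "v \<noteq> r \<and> e = pa v \<and> T.awalk r q (tail G (pa v))" if "T.awalk r (q @ [e]) v" for q e
    proof -
      have "e \<in> arcs T" "head T e = v" "T.awalk r q (tail T e)"
        using that by (auto simp: T.awalk_append_iff T.awalk_Cons_iff T.awalk_Nil_iff)
      moreover from this obtain u where "u \<in> verts G" "u \<noteq> r" "e = pa u"
        unfolding T by blast
      ultimately show ?thesis
        using pa[of u] by (simp add: T)
    qed
    show ?case
    proof (cases "v = r")
      case True
      have "p = []" if "T.awalk r p v" for p
        using that last_arc True by (cases p rule: rev_cases) auto
      moreover have "T.awalk r [] v"
        using True r by (simp add: T.awalk_Nil_iff T)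
      ultimately show ?thesis by blast
    next
      case False
      note pav = pa[OF less.prems False]
      then have "\<exists>!q. T.awalk r q (tail G (pa v))"
        by (intro less.hyps) simp_all
      then obtain q where q: "T.awalk r q (tail G (pa v))"
        and q_unique: "\<And>q'. T.awalk r q' (tail G (pa v)) \<Longrightarrow> q' = q"
        by blast
      have "T.awalk (tail G (pa v)) [pa v] v"
        using T.arc_implies_awalk[of "pa v"] pav less.prems False by (simp add: T)
      with q have "T.awalk r (q @ [pa v]) v"
        by (rule T.awalk_appendI)
      moreover have "p = q @ [pa v]" if "T.awalk r p v" for p
        using that
      proof (cases p rule: rev_cases)
        case Nil
        with that False show ?thesis
          by (simp add: T.awalk_Nil_iff)
      next
        case (snoc q' e)
        with that last_arc q_unique show ?thesis by blast
      qed
      ultimately show ?thesis by blast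
    qed
  qed
  ultimately show ?thesis
    using r unfolding rooted_spanning_tree_def T(1) by blast
qed

section \<open>The O-sequences graph\<close>

lemma wf_digraph_O_graph_length: "wf_digraph (O_graph_length s)"
  unfolding O_graph_length_def
  by (intro wf_digraph.wellformed_induce_subgraph)
     (auto simp: O_graph_def intro!: wf_digraph.intro)

lemma verts_O_graph_length:
  "verts (O_graph_length s) = {h. finite_O_sequence h \<and> seq_length h = s}"
  by (simp add: O_graph_length_def)

theorem proposition2p6:
  fixes s :: nat
  assumes "s \<ge> 1"
  shows "rooted_connected (O_graph_length s) (ones s) \<and>
    (\<exists>T. rooted_spanning_tree T (O_graph_length s) (ones s))"
proof -
  have root: "ones s \<in> verts (O_graph_length s)"
    using assms by (simp add: verts_O_graph_length finite_O_sequence_ones seq_length_ones)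
  \<comment> \<open>The measure is the sum of the first \<open>s\<close> entries, which covers the
    whole support of a vertex.\<close>
  have parent: "\<exists>e\<in>arcs (O_graph_length s). head (O_graph_length s) e = h \<and>
      sum (tail (O_graph_length s) e) {..<s} < sum h {..<s}"
    if hv: "h \<in> verts (O_graph_length s)" and ne: "h \<noteq> ones s" for h
  proof -
    have h: "finite_O_sequence h" and len: "seq_length h = s"
      using hv by (auto simp: verts_O_graph_length)
    then obtain i where i: "1 < h i" and g: "finite_O_sequence (h(i := h i - 1))"
      and len_g: "seq_length (h(i := h i - 1)) = s"
      using ex_decrement ne by metis
    have "(\<lambda>n. int (h n) - int ((h(i := h i - 1)) n)) = unit_seq i"
      using i by (auto simp: unit_seq_def)
    then have "(h(i := h i - 1), h) \<in> arcs (O_graph_length s)"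
      using h g len len_g by (auto simp: O_graph_length_def O_graph_def)
    \<comment> \<open>The lowered index must lie in the range of summation for the sum to
      decrease.\<close>
    moreover have "i < s"
      using finite_O_sequence_eq_0_iff[OF h, of i] i len by linarith
    then have "sum (h(i := h i - 1)) {..<s} < sum h {..<s}"
      using i by (intro sum_strict_mono_ex1) auto
    ultimately show ?thesis
      by (force simp: O_graph_length_def O_graph_def)
  qed
  have "\<exists>T. rooted_spanning_tree T (O_graph_length s) (ones s)"
    using wf_digraph_O_graph_length root parent by (rule ex_rooted_spanning_tree)
  then show ?thesis
    using rooted_connected_of_spanning_tree[OF wf_digraph_O_graph_length] by blast
qed

end
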